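(* Let $(X,d)$ be a metric space and let $f_n:X\to X$, $n\ge 0$, be a sequence of maps, defining the non-autonomous discrete system $x_{n+1}=f_n(x_n)$, $n\ge0$. Let $N\ge 2$ and let $A=(a_{ij})_{N\times N}$ be an irreducible transition matrix with $\sum_{j=1}^{N}a_{i_0j}\ge 2$ for some $1\le i_0\le N$. Let $V_1,\dots,V_N$ be pairwise disjoint nonempty compact subsets of $X$, assume that $\{f_n\}_{n=0}^\infty$ is equi-continuous in $\bigcup_{i=1}^N V_i$, and for each $1\le i\le N$ let $\{V_{i,n}\}_{n=0}^\infty$ be a sequence of nonempty closed subsets of $V_i$. For $\alpha=(a_0,a_1,\dots)\in\Sigma_N^+(A)$ and $m,n\ge0$ put $V_\alpha^{m,n}:=\bigcap_{k=0}^{m}f_n^{-k}(V_{a_k,n+k})$. Suppose that (i) the system is weakly $A$-coupled-expanding in $\{V_{i,n}\}_{n=0}^\infty$, $1\le i\le N$; (ii) there exists a periodic point $\gamma=(r_0,r_1,\dots)\in\Sigma_N^+(A)$ such that the diameter $d(V_\gamma^{m,n})$ converges to $0$ as $m\to\infty$, uniformly with respect to $n\ge0$. Then the system $x_{n+1}=f_n(x_n)$, $n\ge0$, is distributionally $\delta$-chaotic for some $\delta>0$.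
   Context: Notation: for $i\ge0$, $n\ge1$, $f_i^n:=f_{i+n-1}\circ\cdots\circ f_i$, and $f_i^0$ is the identity; $f_i^{-n}(B)=\{x\in X: f_i^n(x)\in B\}$. For a nonempty set $B\subset X$, $d(B):=\sup\{d(x,y):x,y\in B\}$ is its diameter. $\{f_n\}$ is equi-continuous in a set $V$ if for every $\epsilon>0$ there is $\eta>0$ such that $d(f_n(x),f_n(y))<\epsilon$ for all $n\ge0$ and all $x,y\in V$ with $d(x,y)<\eta$. A matrix $A=(a_{ij})_{N\times N}$ ($N\ge2$) is a transition matrix if $a_{ij}\in\{0,1\}$ for all $i,j$, $\sum_{j}a_{ij}\ge1$ for all $i$, and $\sum_i a_{ij}\ge1$ for all $j$. It is irreducible if for each pair $1\le i,j\le N$ there is a positive integer $k$ such that the $(i,j)$ entry of $A^k$ is positive. $\Sigma_N^+(A):=\{(s_0,s_1,\dots): 1\le s_j\le N,\ a_{s_js_{j+1}}=1,\ j\ge0\}$; a point of $\Sigma_N^+(A)$ is periodic if it is periodic under the shift $\sigma_A((s_0,s_1,s_2,\dots))=(s_1,s_2,\dots)$. Given sequences $\{V_{i,n}\}_{n\ge0}$, $1\le i\le N$, of nonempty subsets of $X$ with $V_{i,n}\cap V_{j,n}=\partial V_{i,n}\cap\partial V_{j,n}$ for all $i\ne j$ and $n\ge0$ ($\partial$ denotes boundary), the system is weakly $A$-coupled-expanding in $\{V_{i,n}\}_{n=0}^\infty$, $1\le i\le N$, if $f_n(V_{i,n})\supset\bigcup_{j:\,a_{ij}=1}V_{j,n+1}$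 for all $1\le i\le N$, $n\ge0$. The system $x_{n+1}=f_n(x_n)$ is distributionally $\delta$-chaotic ($\delta>0$) if there is an uncountable set $D\subset X$ such that for all distinct $x,y\in D$ and every $\epsilon>0$, $$\limsup_{n\to\infty}\frac1n\sum_{j=0}^{n-1}\chi_{[0,\epsilon)}\big(d(f_0^{j}(x),f_0^{j}(y))\big)=1,\qquad \liminf_{n\to\infty}\frac1n\sum_{j=0}^{n-1}\chi_{[0,\delta)}\big(d(f_0^{j}(x),f_0^{j}(y))\big)=0,$$ where $\chi_{[0,\epsilon)}$ is the characteristic function of $[0,\epsilon)$. *)

theory Defs
  imports "HOL-Analysis.Analysis" "Jordan_Normal_Form.Matrix"
begin

subsection \<open>Non-autonomous systems\<close>

text \<open>The metric space \<open>X\<close> is the whole carrier type \<open>'a\<close>, and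
  \<open>nds_iter f i n\<close> is \<open>f\<^sub>i\<^sup>n = f (i + n - 1) \<circ> \<dots> \<circ> f i\<close>.\<close>

primrec nds_iter :: "(nat \<Rightarrow> 'a \<Rightarrow> 'a) \<Rightarrow> nat \<Rightarrow> nat \<Rightarrow> 'a \<Rightarrow> 'a" where
  "nds_iter f i 0 = id"
| "nds_iter f i (Suc n) = f (i + n) \<circ> nds_iter f i n"

definition equi_continuous_in :: "'a set \<Rightarrow> (nat \<Rightarrow> 'a \<Rightarrow> 'a::metric_space) \<Rightarrow> bool" where
  "equi_continuous_in V f \<longleftrightarrow>
     (\<forall>\<epsilon>>0. \<exists>\<eta>>0. \<forall>n. \<forall>x\<in>V. \<forall>y\<in>V. dist x y < \<eta> \<longrightarrow> dist (f n x) (f n y) < \<epsilon>)"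

text \<open>The value at \<open>n = 0\<close> is \<open>0\<close> (division by zero); it does not affect the upper and lower
  limits, which are taken in the extended reals.\<close>

definition proximity_frequency ::
    "(nat \<Rightarrow> 'a \<Rightarrow> 'a::metric_space) \<Rightarrow> real \<Rightarrow> 'a \<Rightarrow> 'a \<Rightarrow> nat \<Rightarrow> real" where
  "proximity_frequency f \<epsilon> x y n =
     (1 / real n) *
       (\<Sum>j<n. indicator {0..<\<epsilon>} (dist (nds_iter f 0 j x) (nds_iter f 0 j y)))"

definition distributionally_chaotic :: "real \<Rightarrow> (nat \<Rightarrow> 'a \<Rightarrow> 'a::metric_space) \<Rightarrow> bool" where
  "distributionally_chaotic \<delta> f \<longleftrightarrow>
     (\<exists>D. uncountable D \<and>
       (\<forall>x\<in>D. \<forall>y\<in>D. x \<noteq> y \<longrightarrow>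
         (\<forall>\<epsilon>>0. limsup (\<lambda>n. ereal (proximity_frequency f \<epsilon> x y n)) = 1 \<and>
                liminf (\<lambda>n. ereal (proximity_frequency f \<delta> x y n)) = 0)))"

subsection \<open>Transition matrices and one-sided subshifts\<close>

text \<open>Rows, columns and symbols are numbered \<open>0, \<dots>, N - 1\<close>, the index convention of
  the matrix library, instead of \<open>1, \<dots>, N\<close>.\<close>

definition transition_matrix :: "nat \<Rightarrow> nat mat \<Rightarrow> bool" where
  "transition_matrix N A \<longleftrightarrow>
     2 \<le> N \<and> A \<in> carrier_mat N N \<and>
     (\<forall>i<N. \<forall>j<N. A $$ (i, j) \<in> {0, 1}) \<and>
     (\<forall>i<N. (\<Sum>j<N. A $$ (i, j)) \<ge> 1) \<and>
     (\<forall>j<N. (\<Sum>i<N. A $$ (i, j)) \<ge> 1)"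

definition irreducible_matrix :: "nat \<Rightarrow> nat mat \<Rightarrow> bool" where
  "irreducible_matrix N A \<longleftrightarrow> (\<forall>i<N. \<forall>j<N. \<exists>k>0. (A ^\<^sub>m k) $$ (i, j) > 0)"

definition subshift :: "nat \<Rightarrow> nat mat \<Rightarrow> (nat \<Rightarrow> nat) set" where
  "subshift N A = {s. \<forall>j. s j < N \<and> A $$ (s j, s (Suc j)) = 1}"

definition shift_map :: "(nat \<Rightarrow> 's) \<Rightarrow> nat \<Rightarrow> 's" where
  "shift_map s = (\<lambda>j. s (Suc j))"

definition shift_periodic :: "(nat \<Rightarrow> 's) \<Rightarrow> bool" where
  "shift_periodic s \<longleftrightarrow> (\<exists>p>0. (shift_map ^^ p) s = s)"

subsection \<open>Coupled expansion\<close>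

text \<open>\<open>V i n\<close> stands for \<open>V\<^sub>i\<^sub>,\<^sub>n\<close>.\<close>

definition weakly_coupled_expanding ::
    "nat \<Rightarrow> nat mat \<Rightarrow> (nat \<Rightarrow> 'a \<Rightarrow> 'a::metric_space) \<Rightarrow> (nat \<Rightarrow> nat \<Rightarrow> 'a set) \<Rightarrow> bool" where
  "weakly_coupled_expanding N A f V \<longleftrightarrow>
     (\<forall>i<N. \<forall>n. V i n \<noteq> {}) \<and>
     (\<forall>i<N. \<forall>j<N. \<forall>n. i \<noteq> j \<longrightarrow> V i n \<inter> V j n = frontier (V i n) \<inter> frontier (V j n)) \<and>
     (\<forall>i<N. \<forall>n. (\<Union>j\<in>{j. j < N \<and> A $$ (i, j) = 1}. V j (Suc n)) \<subseteq> f n ` V i n)"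

definition itinerary_set ::
    "(nat \<Rightarrow> 'a \<Rightarrow> 'a) \<Rightarrow> (nat \<Rightarrow> nat \<Rightarrow> 'a set) \<Rightarrow> (nat \<Rightarrow> nat) \<Rightarrow> nat \<Rightarrow> nat \<Rightarrow> 'a set" where
  "itinerary_set f V a m n = (\<Inter>k\<in>{..m}. nds_iter f n k -` V (a k) (n + k))"

end

theory Submission
  imports Defs
begin

text \<open>Equicontinuity makes closeness at one time persist, and separation at one time
  propagate backwards, over any fixed number of steps. Irreducibility and the branching vertex
  yield a second periodic admissible sequence, through the same vertex \<open>r\<^sub>0\<close>, which differs from
  \<open>\<gamma>\<close> somewhere in each common period \<open>L\<close>. Concatenate blocks of length \<open>L\<close> of both sequences,
  arranged in stretches with factorially growing end points: in every other stretch only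
  \<open>\<gamma>\<close>-blocks are used, so all orbits are close there, and the other stretches code, each one
  infinitely often, whether \<open>i\<close> belongs to a given set of natural numbers. Two different sets
  give orbits that are in different \<open>V i\<close> at least once in every \<open>L\<close> steps of
  infinitely many stretches. Itineraries differing at \<^emph>\<open>all\<close> times of a stretch
  need not exist, which is why the backward propagation of separation is required.\<close>

subsection \<open>Orbits\<close>

lemma nds_iter_nds_iter: "nds_iter f (i + m) n (nds_iter f i m x) = nds_iter f i (m + n) x"
  by (induction n) (simp_all add: add.assoc)

text \<open>One \<open>\<eta>\<close> serves all times \<open>n\<close> and all pairs of orbits in
  \<open>U\<close>. Read directly, it prolongs closeness; read contrapositively, a gap of \<epsilon>
  at time \<open>n + r\<close> forces a gap of \<open>\<eta>\<close> at time
  \<open>n\<close>.\<close>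

lemma equi_continuous_in_orbit:
  assumes "equi_continuous_in U f" "\<epsilon> > 0"
  shows "\<exists>\<eta>>0. \<forall>x y n. (\<forall>t. nds_iter f 0 t x \<in> U) \<longrightarrow> (\<forall>t. nds_iter f 0 t y \<in> U) \<longrightarrow>
    dist (nds_iter f 0 n x) (nds_iter f 0 n y) < \<eta> \<longrightarrow>
    (\<forall>r\<le>K. dist (nds_iter f 0 (n + r) x) (nds_iter f 0 (n + r) y) < \<epsilon>)"
  using assms(2)
proof (induction K arbitrary: \<epsilon>)
  case 0
  then show ?case by auto
next
  case (Suc K)
  obtain \<eta> where \<eta>: "\<eta> > 0"
    "\<And>n x y. x \<in> U \<Longrightarrow> y \<in> U \<Longrightarrow> dist x y < \<eta> \<Longrightarrow> dist (f n x) (f n y) < \<epsilon>"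
    using assms(1) Suc.prems unfolding equi_continuous_in_def by metis
  \<comment> \<open>With the bound \<open>min \<epsilon> \<eta>\<close>, the induction hypothesis
    gives both the claim up to step \<open>K\<close> and the input for the last application of
    \<open>f\<close>.\<close>
  obtain \<eta>' where \<eta>': "\<eta>' > 0"
    "\<And>x y n r. \<lbrakk>\<And>t. nds_iter f 0 t x \<in> U; \<And>t. nds_iter f 0 t y \<in> U;
      dist (nds_iter f 0 n x) (nds_iter f 0 n y) < \<eta>'; r \<le> K\<rbrakk> \<Longrightarrow>
      dist (nds_iter f 0 (n + r) x) (nds_iter f 0 (n + r) y) < min \<epsilon> \<eta>"
    using Suc.IH[of "min \<epsilon> \<eta>"] Suc.prems \<eta>(1) by (metis min_less_iff_conj)
  show ?case
  proof (intro exI[of _ \<eta>'] conjI allI impI)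
    fix x y n r
    assume *: "\<forall>t. nds_iter f 0 t x \<in> U" "\<forall>t. nds_iter f 0 t y \<in> U"
      "dist (nds_iter f 0 n x) (nds_iter f 0 n y) < \<eta>'" "r \<le> Suc K"
    show "dist (nds_iter f 0 (n + r) x) (nds_iter f 0 (n + r) y) < \<epsilon>"
    proof (cases "r \<le> K")
      case True
      then show ?thesis using \<eta>'(2)[of x y n r] * by simp
    next
      case False
      then have "r = Suc K" using *(4) by simp
      moreover have "dist (nds_iter f 0 (n + K) x) (nds_iter f 0 (n + K) y) < \<eta>"
        using \<eta>'(2)[of x y n K] * by simp
      ultimately show ?thesis using \<eta>(2) * by simp
    qed
  qed (rule \<eta>'(1))
qed

section \<open>Separation of compact sets and realization of itineraries\<close>

lemma compact_family_separated:
  fixes V :: "'i \<Rightarrow> 'a::metric_space set"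
  assumes "finite I" "disjoint_family_on V I" "\<And>i. i \<in> I \<Longrightarrow> compact (V i)"
  shows "\<exists>d>0. \<forall>i\<in>I. \<forall>j\<in>I. i \<noteq> j \<longrightarrow> (\<forall>x\<in>V i. \<forall>y\<in>V j. d \<le> dist x y)"
proof -
  \<comment> \<open>Each pair admits all sufficiently small \<open>d\<close>, because the distance
    attains a positive minimum on the compact product. The filter \<open>at_right 0\<close> then
    combines the finitely many pairs without an explicit minimum.\<close>
  have "\<forall>\<^sub>F d in at_right (0::real). i \<noteq> j \<longrightarrow> (\<forall>x\<in>V i. \<forall>y\<in>V j. d \<le> dist x y)"
    if ij: "i \<in> I" "j \<in> I" for i j
  proof (cases "i = j \<or> V i \<times> V j = {}")
    case True
    then have "i \<noteq> j \<longrightarrow> (\<forall>x\<in>V i. \<forall>y\<in>V j. d \<le> dist x y)" for d :: real by blast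
    then show ?thesis by simp
  next
    case False
    have "compact (V i \<times> V j)" using assms(3) ij by (intro compact_Times) auto
    moreover have "continuous_on (V i \<times> V j) (\<lambda>q. dist (fst q) (snd q))"
      by (intro continuous_intros)
    ultimately have "\<exists>p\<in>V i \<times> V j. \<forall>q\<in>V i \<times> V j. dist (fst p) (snd p) \<le> dist (fst q) (snd q)"
      using False by (intro continuous_attains_inf) simp_all
    then obtain p where p: "p \<in> V i \<times> V j"
      "\<And>q. q \<in> V i \<times> V j \<Longrightarrow> dist (fst p) (snd p) \<le> dist (fst q) (snd q)"
      by blast
    have "dist (fst p) (snd p) > 0"
      using p(1) False assms(2) ij unfolding disjoint_family_on_def by fastforce
    then have "\<forall>\<^sub>F d in at_right 0. d < dist (fst p) (snd p)"
      by (rule order_tendstoD(2)[OF tendsto_ident_at])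
    then show ?thesis
      by eventually_elim (use p(2) in fastforce)
  qed
  then have "\<forall>\<^sub>F d in at_right 0. \<forall>i\<in>I. \<forall>j\<in>I. i \<noteq> j \<longrightarrow> (\<forall>x\<in>V i. \<forall>y\<in>V j. d \<le> dist x y)"
    using assms(1) by (simp add: eventually_ball_finite)
  moreover have "\<forall>\<^sub>F d in at_right (0::real). d > 0"
    by (rule eventually_at_right_less)
  ultimately have "\<forall>\<^sub>F d in at_right 0. d > 0 \<and>
      (\<forall>i\<in>I. \<forall>j\<in>I. i \<noteq> j \<longrightarrow> (\<forall>x\<in>V i. \<forall>y\<in>V j. d \<le> dist x y))"
    by eventually_elim simp
  then show ?thesis
    by (intro eventually_happens'[OF trivial_limit_at_right_real])
qed

text \<open>Pulling a point of \<open>B m\<close> back through the coverings gives a start whose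
  orbit follows \<open>B\<close> up to time \<open>m\<close>. Compactness of \<open>B 0\<close>
  yields a limit \<open>z\<close> of such starts, and closedness passes every condition on to
  \<open>z\<close>.\<close>

lemma itinerary_realized:
  fixes f :: "nat \<Rightarrow> 'a::metric_space \<Rightarrow> 'a"
  assumes exp: "\<And>t. B (Suc t) \<subseteq> f t ` B t"
    and ne: "\<And>t. B t \<noteq> {}" and cl: "\<And>t. closed (B t)" and comp: "compact (B 0)"
    and BU: "\<And>t. B t \<subseteq> U" and cont: "\<And>t. continuous_on U (f t)"
  shows "\<exists>z. \<forall>t. nds_iter f 0 t z \<in> B t"
proof -
  have pre: "\<exists>x. nds_iter f 0 m x = y \<and> (\<forall>t\<le>m. nds_iter f 0 t x \<in> B t)" if "y \<in> B m" for m y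
    using that
  proof (induction m arbitrary: y)
    case 0
    then show ?case by simp
  next
    case (Suc m)
    then obtain w where w: "w \<in> B m" "y = f m w" using exp by blast
    with Suc.IH obtain x where "nds_iter f 0 m x = w" "\<forall>t\<le>m. nds_iter f 0 t x \<in> B t" by blast
    with w Suc.prems show ?case by (intro exI[of _ x]) (auto simp: le_Suc_eq)
  qed
  have "\<exists>x. \<forall>t\<le>m. nds_iter f 0 t x \<in> B t" for m
    using pre ne[of m] by blast
  then obtain x where x: "\<And>m t. t \<le> m \<Longrightarrow> nds_iter f 0 t (x m) \<in> B t" by metis
  have "\<forall>m. x m \<in> B 0" using x[of 0] by simp
  then obtain z r where z: "z \<in> B 0" and r: "strict_mono r" "(x \<circ> r) \<longlonglongrightarrow> z"
    using comp unfolding compact_def by blast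
  \<comment> \<open>Membership and convergence go through one induction: \<open>f t\<close> is
    continuous only on \<open>U\<close>, so the limit at time \<open>t\<close> must be known to lie
    in \<open>B t\<close> before the next step.\<close>
  have "nds_iter f 0 t z \<in> B t \<and> (\<lambda>k. nds_iter f 0 t (x (r k))) \<longlonglongrightarrow> nds_iter f 0 t z" for t
  proof (induction t)
    case 0
    then show ?case using z r(2) by (simp add: o_def)
  next
    case (Suc t)
    have ev: "\<forall>\<^sub>F k in sequentially. nds_iter f 0 s (x (r k)) \<in> B s" for s
      unfolding eventually_sequentially using x seq_suble[OF r(1)] order_trans by blast
    have "(\<lambda>k. f t (nds_iter f 0 t (x (r k)))) \<longlonglongrightarrow> f t (nds_iter f 0 t z)"
      by (rule continuous_on_tendsto_compose[OF cont[of t]])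
        (use Suc BU[of t] ev[of t] in \<open>auto elim: eventually_mono\<close>)
    then have lim: "(\<lambda>k. nds_iter f 0 (Suc t) (x (r k))) \<longlonglongrightarrow> nds_iter f 0 (Suc t) z" by simp
    have "nds_iter f 0 (Suc t) z \<in> B (Suc t)"
      using Lim_in_closed_set[OF cl ev _ lim] by simp
    with lim show ?case by blast
  qed
  then show ?thesis by blast
qed

subsection \<open>Admissible sequences\<close>

text \<open>Natural numbers cannot cancel, so a positive entry of a product has a positive summand,
  which supplies the last edge of a walk.\<close>

lemma pow_mat_pos_imp_relpow:
  fixes A :: "nat mat"
  assumes "A \<in> carrier_mat N N" "i < N" "j < N" "(A ^\<^sub>m k) $$ (i, j) > 0"
  shows "(i, j) \<in> {(i, j). i < N \<and> j < N \<and> A $$ (i, j) > 0} ^^ k"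
  using assms(3,4)
proof (induction k arbitrary: j)
  case 0
  then show ?case using assms(1,2) by (auto split: if_splits)
next
  case (Suc k)
  have "A ^\<^sub>m k \<in> carrier_mat N N" using assms(1) by (rule pow_carrier_mat)
  then have "(A ^\<^sub>m Suc k) $$ (i, j) = (\<Sum>l<N. (A ^\<^sub>m k) $$ (i, l) * A $$ (l, j))"
    using assms(1,2) Suc.prems(1) by (auto simp: scalar_prod_def atLeast0LessThan)
  with Suc.prems(2) obtain l where "l < N" "(A ^\<^sub>m k) $$ (i, l) > 0" "A $$ (l, j) > 0"
    by (metis (no_types, lifting) lessThan_iff mult_eq_0_iff not_gr_zero sum.neutral)
  with Suc.IH[of l] Suc.prems(1) show ?case by auto
qed

lemma relpow_periodic_walk:
  assumes "(a, c) \<in> E ^^ m" "(c, a) \<in> E ^^ n" "n > 0"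
  shows "\<exists>\<mu>. (\<forall>t. (\<mu> t, \<mu> (Suc t)) \<in> E) \<and> (\<forall>t. \<mu> (t + (m + n)) = \<mu> t) \<and> \<mu> 0 = a \<and> \<mu> m = c"
proof -
  obtain g where g: "g 0 = a" "g m = c" "\<And>i. i < m \<Longrightarrow> (g i, g (Suc i)) \<in> E"
    using assms(1) unfolding relpow_fun_conv by blast
  obtain h where h: "h 0 = c" "h n = a" "\<And>i. i < n \<Longrightarrow> (h i, h (Suc i)) \<in> E"
    using assms(2) unfolding relpow_fun_conv by blast
  define w where "w i = (if i < m then g i else h (i - m))" for i
  have w: "w 0 = a" "w m = c" "w (m + n) = a"
    using g(1,2) h(1,2) by (auto simp: w_def)
  have step: "(w i, w (Suc i)) \<in> E" if "i < m + n" for i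
  proof -
    consider "Suc i < m" | "Suc i = m" | "m \<le> i" by linarith
    then show ?thesis
    proof cases
      case 1
      then show ?thesis using g(3)[of i] by (simp add: w_def)
    next
      case 2
      then show ?thesis using g(3)[of i] g(2) h(1) by (simp add: w_def)
    next
      case 3
      then show ?thesis using h(3)[of "i - m"] that by (simp add: w_def Suc_diff_le)
    qed
  qed
  \<comment> \<open>The closed walk \<open>w\<close> is repeated with period \<open>m + n\<close>;
    \<open>n > 0\<close> keeps position \<open>m\<close> below the period, so \<open>c\<close> is
    still visited at time \<open>m\<close>.\<close>
  have "(w (t mod (m + n)), w (Suc t mod (m + n))) \<in> E" for t
    using step[of "t mod (m + n)"] w(1,3) assms(3) by (auto simp: mod_Suc)
  then show ?thesis
    using w assms(3) by (intro exI[of _ "\<lambda>t. w (t mod (m + n))"]) auto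
qed

lemma shift_map_funpow: "(shift_map ^^ p) s = (\<lambda>j. s (j + p))"
  by (induction p arbitrary: s) (simp_all add: shift_map_def)

lemma periodic_add_mult:
  assumes "\<And>t::nat. s (t + p) = s t"
  shows "s (t + k * p) = s t"
proof (induction k)
  case (Suc k)
  have "t + Suc k * p = (t + k * p) + p" by simp
  then show ?case using assms Suc by metis
qed simp

text \<open>The new walk goes from \<open>\<gamma> 0\<close> to the branching vertex in
  \<open>k\<close> steps, leaves it for a successor other than \<open>\<gamma> (Suc k)\<close>, and
  returns to \<open>\<gamma> 0\<close>. The comparison is with the symbol of \<gamma> at time
  \<open>Suc k\<close>, wherever \<gamma> is at time \<open>k\<close>.\<close>

lemma subshift_second_periodic:
  assumes A: "transition_matrix N A" "irreducible_matrix N A"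
    and i0: "i0 < N" "(\<Sum>j<N. A $$ (i0, j)) \<ge> 2"
    and \<gamma>: "\<gamma> \<in> subshift N A" "shift_periodic \<gamma>"
  shows "\<exists>\<mu>\<in>subshift N A. \<exists>L>0. \<exists>b<L. \<mu> 0 = \<gamma> 0 \<and> \<mu> b \<noteq> \<gamma> b \<and>
    (\<forall>t k. \<mu> (t + k * L) = \<mu> t) \<and> (\<forall>t k. \<gamma> (t + k * L) = \<gamma> t)"
proof -
  define E where "E = {(i, j). i < N \<and> j < N \<and> A $$ (i, j) > 0}"
  have carr: "A \<in> carrier_mat N N"
    using A(1) unfolding transition_matrix_def by blast
  have A01: "A $$ (i, j) = 0 \<or> A $$ (i, j) = 1" if "i < N" "j < N" for i j
    using A(1) that unfolding transition_matrix_def by blast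
  have E: "\<exists>k>0. (i, j) \<in> E ^^ k" if ij: "i < N" "j < N" for i j
  proof -
    obtain k where "k > 0" "(A ^\<^sub>m k) $$ (i, j) > 0"
      using A(2) ij unfolding irreducible_matrix_def by blast
    then show ?thesis
      using pow_mat_pos_imp_relpow[OF carr ij] unfolding E_def by blast
  qed
  \<comment> \<open>A row of zeros and ones with sum at least 2 offers two successors, so one of
    them avoids any given \<open>e\<close>.\<close>
  have "\<exists>c. c < N \<and> A $$ (i0, c) = 1 \<and> c \<noteq> e" for e
  proof (rule ccontr)
    assume "\<not> ?thesis"
    then have "A $$ (i0, j) = 0" if "j < N" "j \<noteq> e" for j
      using A01[OF i0(1)] that by blast
    then have "(\<Sum>j<N. A $$ (i0, j)) = (\<Sum>j<N. if j = e then A $$ (i0, j) else 0)"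
      by (intro sum.cong) auto
    also have "\<dots> \<le> 1" using A01[OF i0(1), of e] by (auto simp: sum.delta)
    finally show False using i0(2) by simp
  qed
  moreover have \<gamma>0: "\<gamma> 0 < N" using \<gamma>(1) by (simp add: subshift_def)
  then obtain k where k: "(\<gamma> 0, i0) \<in> E ^^ k" using E i0(1) by blast
  ultimately obtain c where c: "c < N" "A $$ (i0, c) = 1" "c \<noteq> \<gamma> (Suc k)" by blast
  have kc: "(\<gamma> 0, c) \<in> E ^^ Suc k"
    using k c i0(1) by (auto simp: E_def)
  obtain n where n: "n > 0" "(c, \<gamma> 0) \<in> E ^^ n" using E c(1) \<gamma>0 by blast
  obtain \<mu> where \<mu>: "\<And>t. (\<mu> t, \<mu> (Suc t)) \<in> E" "\<And>t. \<mu> (t + (Suc k + n)) = \<mu> t"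
    "\<mu> 0 = \<gamma> 0" "\<mu> (Suc k) = c"
    using relpow_periodic_walk[OF kc n(2,1)] by blast
  obtain p where p: "p > 0" "\<And>t. \<gamma> (t + p) = \<gamma> t"
    using \<gamma>(2) unfolding shift_periodic_def shift_map_funpow by metis
  \<comment> \<open>A common multiple of both periods; \<open>n > 0\<close> and \<open>p > 0\<close>
    make it exceed \<open>Suc k\<close>, so the disagreement lies inside one period.\<close>
  define L where "L = (Suc k + n) * p"
  have "L > Suc k" using n(1) p(1) unfolding L_def
    by (metis One_nat_def Suc_leI less_add_same_cancel1 mult.right_neutral mult_le_mono2 order_less_le_trans)
  moreover have "\<mu> \<in> subshift N A"
    unfolding subshift_def using \<mu>(1) A01 by (fastforce simp: E_def)
  moreover have "\<mu> (t + j * L) = \<mu> t" "\<gamma> (t + j * L) = \<gamma> t" for t j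
    using periodic_add_mult[of \<mu> "Suc k + n" t "j * p"] \<mu>(2)
      periodic_add_mult[of \<gamma> p t "j * (Suc k + n)"] p(2)
    by (simp_all add: L_def algebra_simps)
  ultimately show ?thesis
    using \<mu>(3,4) c(3) by (intro bexI[of _ \<mu>] exI[of _ L] conjI exI[of _ "Suc k"]) auto
qed

subsection \<open>Upper and lower densities\<close>

text \<open>Lower density zero of the times satisfying \<open>Q\<close>, written without division.
  Applied to closeness it yields the lower limit 0, applied to the negation of closeness the upper
  limit 1.\<close>

definition thin_along :: "(nat \<Rightarrow> bool) \<Rightarrow> bool" where
  "thin_along Q \<longleftrightarrow> (\<forall>e>0. \<exists>\<^sub>F n in sequentially. real (card {j. j < n \<and> Q j}) \<le> e * real n)"

text \<open>At \<open>n = L * fact (Suc k)\<close> only the times below \<open>L * fact k\<close>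
  and the last \<open>M\<close> times can satisfy \<open>Q\<close>; they are at most a fraction
  \<open>(1 + M) / (k + 1)\<close> of \<open>n\<close>.\<close>

lemma thin_along_factorial:
  assumes L: "L > 0"
    and Q: "\<And>n. \<exists>k\<ge>n. \<forall>j. L * fact k \<le> j \<longrightarrow> j + M < L * fact (Suc k) \<longrightarrow> \<not> Q j"
  shows "thin_along Q"
  unfolding thin_along_def frequently_sequentially
proof (intro allI impI)
  fix e :: real and n0 :: nat
  assume e: "e > 0"
  obtain k0 :: nat where k0: "real k0 > (1 + real M) / e" using reals_Archimedean2 by blast
  obtain k where k: "k \<ge> max n0 k0" and
    Qk: "\<And>j. L * fact k \<le> j \<Longrightarrow> j + M < L * fact (Suc k) \<Longrightarrow> \<not> Q j"
    using Q[of "max n0 k0"] by blast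
  define n where "n = L * fact (Suc k)"
  have "{j. j < n \<and> Q j} \<subseteq> {..<L * fact k} \<union> {n - M..<n}"
    using Qk by (fastforce simp: n_def not_le)
  then have "card {j. j < n \<and> Q j} \<le> card ({..<L * fact k} \<union> {n - M..<n})"
    by (intro card_mono) auto
  also have "\<dots> \<le> card {..<L * fact k} + card {n - M..<n}"
    by (rule card_Un_le)
  also have "\<dots> \<le> L * fact k + M" by simp
  finally have "real (card {j. j < n \<and> Q j}) \<le> real (L * fact k + M)"
    by (simp only: of_nat_le_iff)
  also have "\<dots> \<le> real (L * fact k) * (1 + real M)"
  proof -
    have "real (L * fact k) \<ge> 1"
      using L by (metis One_nat_def Suc_leI fact_gt_zero nat_0_less_mult_iff of_nat_1 of_nat_le_iff)
    then have "1 * real M \<le> real (L * fact k) * real M" by (rule mult_right_mono) simp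
    then show ?thesis by (simp add: algebra_simps)
  qed
  also have "\<dots> \<le> real (L * fact k) * (e * real (Suc k))"
  proof (rule mult_left_mono)
    have "1 + real M \<le> e * real k0" using k0 e by (simp add: field_simps)
    also have "\<dots> \<le> e * real (Suc k)" using k e by (intro mult_left_mono) auto
    finally show "1 + real M \<le> e * real (Suc k)" .
  qed simp
  also have "\<dots> = e * real n" by (simp add: n_def algebra_simps)
  finally have "real (card {j. j < n \<and> Q j}) \<le> e * real n" .
  moreover have "n \<ge> n0"
  proof -
    have "n0 \<le> Suc k" using k by simp
    also have "\<dots> \<le> fact (Suc k)" by (rule fact_ge_self)
    also have "\<dots> \<le> n" using L by (simp add: n_def)
    finally show ?thesis .
  qed
  ultimately show "\<exists>n\<ge>n0. real (card {j. j < n \<and> Q j}) \<le> e * real n" by blast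
qed

section \<open>Proximity frequencies as relative counts, and their limits\<close>

lemma proximity_frequency_card:
  "proximity_frequency f \<epsilon> x y n =
    real (card {j. j < n \<and> dist (nds_iter f 0 j x) (nds_iter f 0 j y) < \<epsilon>}) / real n"
proof -
  have "(\<Sum>j<n. indicator {0..<\<epsilon>} (dist (nds_iter f 0 j x) (nds_iter f 0 j y)) :: real) =
      (\<Sum>j<n. if dist (nds_iter f 0 j x) (nds_iter f 0 j y) < \<epsilon> then 1 else 0)"
    by (intro sum.cong) (auto simp: indicator_def)
  also have "\<dots> = real (card {j. j < n \<and> dist (nds_iter f 0 j x) (nds_iter f 0 j y) < \<epsilon>})"
    by (simp add: sum.If_cases Collect_conj_eq lessThan_def)
  finally show ?thesis by (simp add: proximity_frequency_def)
qed

lemma proximity_frequency_bounds: "0 \<le> proximity_frequency f \<epsilon> x y n" "proximity_frequency f \<epsilon> x y n \<le> 1"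
proof -
  have "card {j. j < n \<and> dist (nds_iter f 0 j x) (nds_iter f 0 j y) < \<epsilon>} \<le> card {..<n}"
    by (intro card_mono) auto
  then show "proximity_frequency f \<epsilon> x y n \<le> 1"
    by (cases "n = 0") (simp_all add: proximity_frequency_card divide_le_eq_1)
qed (simp add: proximity_frequency_card)

lemma liminf_proximity_frequency_eq_0:
  assumes "thin_along (\<lambda>j. dist (nds_iter f 0 j x) (nds_iter f 0 j y) < \<delta>)"
  shows "liminf (\<lambda>n. ereal (proximity_frequency f \<delta> x y n)) = 0"
proof (rule antisym)
  have "liminf (\<lambda>n. ereal (proximity_frequency f \<delta> x y n)) \<le> 0 + ereal e" if e: "e > 0" for e
  proof -
    have "\<exists>\<^sub>F n in sequentially. n > 0 \<and>
        real (card {j. j < n \<and> dist (nds_iter f 0 j x) (nds_iter f 0 j y) < \<delta>}) \<le> e * real n"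
      using assms e unfolding thin_along_def
      by (intro frequently_eventually_conj eventually_gt_at_top) blast
    then have fr: "\<exists>\<^sub>F n in sequentially. proximity_frequency f \<delta> x y n \<le> e"
      by (rule frequently_elim1) (auto simp: proximity_frequency_card field_simps)
    show ?thesis
    proof (rule ccontr)
      assume "\<not> ?thesis"
      then have "\<forall>\<^sub>F n in sequentially. ereal e < ereal (proximity_frequency f \<delta> x y n)"
        by (intro less_LiminfD) simp
      then show False using fr
        by (simp add: frequently_def not_le)
    qed
  qed
  then show "liminf (\<lambda>n. ereal (proximity_frequency f \<delta> x y n)) \<le> 0"
    by (rule ereal_le_epsilon2)
  show "0 \<le> liminf (\<lambda>n. ereal (proximity_frequency f \<delta> x y n))"
    by (intro Liminf_bounded always_eventually) (simp add: proximity_frequency_bounds)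
qed

lemma limsup_proximity_frequency_eq_1:
  assumes "thin_along (\<lambda>j. \<not> dist (nds_iter f 0 j x) (nds_iter f 0 j y) < \<epsilon>)"
  shows "limsup (\<lambda>n. ereal (proximity_frequency f \<epsilon> x y n)) = 1"
proof (rule antisym)
  show "limsup (\<lambda>n. ereal (proximity_frequency f \<epsilon> x y n)) \<le> 1"
    by (intro Limsup_bounded always_eventually) (simp add: proximity_frequency_bounds)
  \<comment> \<open>At \<open>n = 0\<close> the proximity frequency is 0 and not 1, hence the
    restriction of the complement formula to \<open>n > 0\<close>.\<close>
  have *: "proximity_frequency f \<epsilon> x y n = 1 -
      real (card {j. j < n \<and> \<not> dist (nds_iter f 0 j x) (nds_iter f 0 j y) < \<epsilon>}) / real n"
    if "n > 0" for n
  proof -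
    have "{..<n} = {j. j < n \<and> dist (nds_iter f 0 j x) (nds_iter f 0 j y) < \<epsilon>} \<union>
        {j. j < n \<and> \<not> dist (nds_iter f 0 j x) (nds_iter f 0 j y) < \<epsilon>}" by auto
    then have "n = card ({j. j < n \<and> dist (nds_iter f 0 j x) (nds_iter f 0 j y) < \<epsilon>} \<union>
        {j. j < n \<and> \<not> dist (nds_iter f 0 j x) (nds_iter f 0 j y) < \<epsilon>})"
      by (metis card_lessThan)
    also have "\<dots> = card {j. j < n \<and> dist (nds_iter f 0 j x) (nds_iter f 0 j y) < \<epsilon>} +
        card {j. j < n \<and> \<not> dist (nds_iter f 0 j x) (nds_iter f 0 j y) < \<epsilon>}"
      by (intro card_Un_disjoint) auto
    finally show ?thesis
      unfolding proximity_frequency_card using that by (simp add: field_simps flip: of_nat_add)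
  qed
  have "1 \<le> limsup (\<lambda>n. ereal (proximity_frequency f \<epsilon> x y n)) + ereal e" if e: "e > 0" for e
  proof -
    have "\<exists>\<^sub>F n in sequentially. n > 0 \<and>
        real (card {j. j < n \<and> \<not> dist (nds_iter f 0 j x) (nds_iter f 0 j y) < \<epsilon>}) \<le> e * real n"
      using assms e unfolding thin_along_def
      by (intro frequently_eventually_conj eventually_gt_at_top) blast
    then have fr: "\<exists>\<^sub>F n in sequentially. 1 - e \<le> proximity_frequency f \<epsilon> x y n"
      by (rule frequently_elim1) (auto simp: * field_simps)
    have "ereal (1 - e) \<le> limsup (\<lambda>n. ereal (proximity_frequency f \<epsilon> x y n))"
    proof (rule ccontr)
      assume "\<not> ?thesis"
      then have "\<forall>\<^sub>F n in sequentially. ereal (proximity_frequency f \<epsilon> x y n) < ereal (1 - e)"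
        by (intro Limsup_lessD) simp
      then show False using fr
        by (simp add: frequently_def not_le)
    qed
    then have "ereal (1 - e) + ereal e \<le> limsup (\<lambda>n. ereal (proximity_frequency f \<epsilon> x y n)) + ereal e"
      by (rule add_right_mono)
    then show ?thesis by (simp add: one_ereal_def)
  qed
  then show "1 \<le> limsup (\<lambda>n. ereal (proximity_frequency f \<epsilon> x y n))"
    by (rule ereal_le_epsilon2)
qed

subsection \<open>Coding sets of natural numbers\<close>

text \<open>Every number is the first component of \<open>prod_decode q\<close> for infinitely many
  \<open>q\<close>, so each membership bit is repeated in arbitrarily late stretches.\<close>

definition coding_block :: "nat set \<Rightarrow> nat \<Rightarrow> bool" where
  "coding_block x m \<longleftrightarrow>
    (\<exists>q. fst (prod_decode q) \<in> x \<and> fact (2 * q + 1) \<le> m \<and> m < fact (2 * q + 2))"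

lemma fact_interval_unique:
  assumes "fact k \<le> m" "m < fact (Suc k)" "fact l \<le> m" "m < (fact (Suc l) :: nat)"
  shows "k = l"
proof (rule ccontr)
  assume "k \<noteq> l"
  then consider "Suc k \<le> l" | "Suc l \<le> k" by linarith
  then show False
    using fact_mono_nat[of "Suc k" l] fact_mono_nat[of "Suc l" k] assms by cases linarith+
qed

lemma coding_block_even:
  assumes "fact (2 * q) \<le> m" "m < fact (Suc (2 * q))"
  shows "\<not> coding_block x m"
proof
  assume "coding_block x m"
  then obtain l where "fact (2 * l + 1) \<le> m" "m < fact (2 * l + 2)"
    unfolding coding_block_def by blast
  then have "2 * q = 2 * l + 1"
    using assms by (intro fact_interval_unique[of _ m]) (simp_all del: fact_Suc)
  then show False by presburger
qed

lemma coding_block_odd: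
  assumes "fact (2 * q + 1) \<le> m" "m < fact (2 * q + 2)"
  shows "coding_block x m \<longleftrightarrow> fst (prod_decode q) \<in> x"
proof
  assume "coding_block x m"
  then obtain l where l: "fst (prod_decode l) \<in> x" "fact (2 * l + 1) \<le> m" "m < fact (2 * l + 2)"
    unfolding coding_block_def by blast
  then have "2 * q + 1 = 2 * l + 1"
    using assms by (intro fact_interval_unique[of _ m]) (simp_all del: fact_Suc)
  with l(1) show "fst (prod_decode q) \<in> x" by simp
qed (use assms in \<open>auto simp: coding_block_def simp del: fact_Suc\<close>)

text \<open>Both sequences are read at absolute time \<open>t\<close>, not at the time within the
  block; when \<open>L\<close> is a period of both, the two readings agree.\<close>

definition coded_itinerary :: "nat \<Rightarrow> (nat \<Rightarrow> 's) \<Rightarrow> (nat \<Rightarrow> 's) \<Rightarrow> nat set \<Rightarrow> nat \<Rightarrow> 's" where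
  "coded_itinerary L \<mu> \<gamma> x t = (if coding_block x (t div L) then \<mu> t else \<gamma> t)"

text \<open>A change of sequence can occur only at a multiple of \<open>L\<close>, where both have
  the symbol \<open>\<gamma> 0\<close>; hence every transition is one of \<mu> or one of
  \<gamma>.\<close>

lemma coded_itinerary_subshift:
  assumes "\<mu> \<in> subshift N A" "\<gamma> \<in> subshift N A" "L > 0" "\<mu> 0 = \<gamma> 0"
    and per: "\<And>t k. \<mu> (t + k * L) = \<mu> t" "\<And>t k. \<gamma> (t + k * L) = \<gamma> t"
  shows "coded_itinerary L \<mu> \<gamma> x \<in> subshift N A"
proof -
  have "coded_itinerary L \<mu> \<gamma> x (Suc t) =
      (if coding_block x (t div L) then \<mu> (Suc t) else \<gamma> (Suc t))" for t
  proof (cases "Suc t mod L = 0")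
    case True
    then obtain k where "Suc t = 0 + k * L"
      by (metis add_0 dvdE mod_0_imp_dvd mult.commute)
    then have "\<mu> (Suc t) = \<gamma> (Suc t)" using per assms(4) by metis
    then show ?thesis by (simp add: coded_itinerary_def)
  next
    case False
    then have "Suc t div L = t div L" by (simp add: div_Suc)
    then show ?thesis by (simp add: coded_itinerary_def)
  qed
  then show ?thesis
    using assms(1,2) by (auto simp: subshift_def coded_itinerary_def)
qed

lemma coded_itinerary_eq_base:
  assumes "L * fact (2 * q) \<le> t" "t < L * fact (Suc (2 * q))"
  shows "coded_itinerary L \<mu> \<gamma> x t = \<gamma> t"
proof -
  \<comment> \<open>For \<open>L = 0\<close> the upper bound on \<open>t\<close> is
    contradictory.\<close>
  have "fact (2 * q) \<le> t div L" "t div L < fact (Suc (2 * q))"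
    using assms
    by (cases "L = 0"; simp add: less_eq_div_iff_mult_less_eq div_less_iff_less_mult mult.commute
        del: fact_Suc)+
  then show ?thesis by (simp add: coded_itinerary_def coding_block_even del: fact_Suc)
qed

lemma coded_itinerary_differ:
  assumes "L * fact (2 * q + 1) \<le> t" "t < L * fact (2 * q + 2)" "\<mu> t \<noteq> \<gamma> t"
    and "fst (prod_decode q) \<in> x \<longleftrightarrow> fst (prod_decode q) \<notin> y"
  shows "coded_itinerary L \<mu> \<gamma> x t \<noteq> coded_itinerary L \<mu> \<gamma> y t"
proof -
  have "fact (2 * q + 1) \<le> t div L" "t div L < fact (2 * q + 2)"
    using assms(1,2)
    by (cases "L = 0"; simp add: less_eq_div_iff_mult_less_eq div_less_iff_less_mult mult.commute
        del: fact_Suc)+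
  then show ?thesis
    using assms(3,4) by (auto simp add: coded_itinerary_def coding_block_odd simp del: fact_Suc)
qed

lemma uncountable_UNIV_nat_set: "uncountable (UNIV :: nat set set)"
proof
  assume "countable (UNIV :: nat set set)"
  then have "range (from_nat_into (UNIV :: nat set set)) = Pow UNIV"
    by (simp add: range_from_nat_into)
  then show False using Cantors_theorem by metis
qed

section \<open>The uncountable scrambled set and the choice of \<delta>\<close>

theorem theorem4p2:
  fixes f :: "nat \<Rightarrow> 'a \<Rightarrow> 'a::metric_space"
    and N :: nat
    and A :: "nat mat"
    and V :: "nat \<Rightarrow> 'a set"
    and W :: "nat \<Rightarrow> nat \<Rightarrow> 'a set"
  assumes "N \<ge> 2"
    and "transition_matrix N A"
    and "irreducible_matrix N A"
    and "\<exists>i0<N. (\<Sum>j<N. A $$ (i0, j)) \<ge> 2"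
    and "disjoint_family_on V {..<N}"
    and "\<And>i. i < N \<Longrightarrow> V i \<noteq> {}"
    and "\<And>i. i < N \<Longrightarrow> compact (V i)"
    and "equi_continuous_in (\<Union>i<N. V i) f"
    and "\<And>i n. i < N \<Longrightarrow> W i n \<noteq> {}"
    and "\<And>i n. i < N \<Longrightarrow> closed (W i n)"
    and "\<And>i n. i < N \<Longrightarrow> W i n \<subseteq> V i"
    and "weakly_coupled_expanding N A f W"
    and "\<exists>\<gamma>\<in>subshift N A. shift_periodic \<gamma> \<and>
           uniform_limit UNIV (\<lambda>m n. diameter (itinerary_set f W \<gamma> m n)) (\<lambda>n. 0) sequentially"
  shows "\<exists>\<delta>>0. distributionally_chaotic \<delta> f"
proof -
  define U where "U = (\<Union>i<N. V i)"
  obtain \<gamma> where \<gamma>: "\<gamma> \<in> subshift N A" "shift_periodic \<gamma>" and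
    diam: "uniform_limit UNIV (\<lambda>m n. diameter (itinerary_set f W \<gamma> m n)) (\<lambda>n. 0) sequentially"
    using assms(13) by blast
  obtain \<mu> L b where \<mu>: "\<mu> \<in> subshift N A" and L: "L > 0" and b: "b < L" "\<mu> b \<noteq> \<gamma> b"
    and \<mu>0: "\<mu> 0 = \<gamma> 0"
    and per: "\<And>t k. \<mu> (t + k * L) = \<mu> t" "\<And>t k. \<gamma> (t + k * L) = \<gamma> t"
    using subshift_second_periodic[OF assms(2,3) _ _ \<gamma>] assms(4) by metis
  obtain d where d: "d > 0"
    "\<And>i j u v. \<lbrakk>i < N; j < N; i \<noteq> j; u \<in> V i; v \<in> V j\<rbrakk> \<Longrightarrow> d \<le> dist u v"
    using compact_family_separated[OF finite_lessThan assms(5)] assms(7)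
    by (metis lessThan_iff)
  have cont: "continuous_on U (f t)" for t
    unfolding continuous_on_iff
  proof (intro ballI allI impI)
    fix u and e :: real
    assume "u \<in> U" "e > 0"
    then show "\<exists>\<eta>>0. \<forall>v\<in>U. dist v u < \<eta> \<longrightarrow> dist (f t v) (f t u) < e"
      using assms(8) unfolding equi_continuous_in_def U_def by metis
  qed
  define \<alpha> where "\<alpha> = coded_itinerary L \<mu> \<gamma>"
  have \<alpha>: "\<alpha> x \<in> subshift N A" for x
    unfolding \<alpha>_def using \<mu> \<gamma>(1) L \<mu>0 per by (rule coded_itinerary_subshift)
  have \<alpha>N: "\<alpha> x t < N" and \<alpha>A: "A $$ (\<alpha> x t, \<alpha> x (Suc t)) = 1" for x t
    using \<alpha>[of x] unfolding subshift_def by blast+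
  have "\<exists>z. \<forall>t. nds_iter f 0 t z \<in> W (\<alpha> x t) t" for x
  proof (rule itinerary_realized[where U = U])
    show "W (\<alpha> x (Suc t)) (Suc t) \<subseteq> f t ` W (\<alpha> x t) t" for t
    proof -
      have "(\<Union>j\<in>{j. j < N \<and> A $$ (\<alpha> x t, j) = 1}. W j (Suc t)) \<subseteq> f t ` W (\<alpha> x t) t"
        using assms(12) \<alpha>N[of x t] unfolding weakly_coupled_expanding_def by simp
      then show ?thesis using \<alpha>N[of x "Suc t"] \<alpha>A[of x t] by blast
    qed
    show "W (\<alpha> x t) t \<noteq> {}" for t by (rule assms(9)[OF \<alpha>N])
    show "closed (W (\<alpha> x t) t)" for t by (rule assms(10)[OF \<alpha>N])
    show "compact (W (\<alpha> x 0) 0)"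
      using compact_Int_closed[OF assms(7)[OF \<alpha>N] assms(10)[OF \<alpha>N]] assms(11)[OF \<alpha>N]
      by (metis inf.absorb2)
    show "W (\<alpha> x t) t \<subseteq> U" for t
      using assms(11)[OF \<alpha>N, of x t t] \<alpha>N[of x t] unfolding U_def by blast
  qed (rule cont)
  then obtain z where z: "\<And>x t. nds_iter f 0 t (z x) \<in> W (\<alpha> x t) t" by metis
  have zV: "nds_iter f 0 t (z x) \<in> V (\<alpha> x t)" for x t
    using z assms(11) \<alpha>N by blast
  then have zU: "nds_iter f 0 t (z x) \<in> U" for x t
    using \<alpha>N unfolding U_def by blast
  have sep: "d \<le> dist (nds_iter f 0 t (z x)) (nds_iter f 0 t (z y))" if "\<alpha> x t \<noteq> \<alpha> y t" for x y t
    using d(2)[OF \<alpha>N \<alpha>N that zV zV] .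
  \<comment> \<open>Used contrapositively: a gap of \<open>d\<close> within the next
    \<open>2 * L\<close> steps forces a gap of at least \<delta> now. From any time,
    \<open>2 * L\<close> steps suffice to reach position \<open>b\<close> of the following
    block.\<close>
  obtain \<delta> where \<delta>: "\<delta> > 0"
    "\<And>x y n r. \<lbrakk>dist (nds_iter f 0 n (z x)) (nds_iter f 0 n (z y)) < \<delta>; r \<le> 2 * L\<rbrakk> \<Longrightarrow>
      dist (nds_iter f 0 (n + r) (z x)) (nds_iter f 0 (n + r) (z y)) < d"
    using equi_continuous_in_orbit[OF assms(8) d(1), of "2 * L"] zU unfolding U_def by metis

  \<comment> \<open>The conjunct \<open>z x \<noteq> z y\<close> is carried along to obtain
    injectivity of \<open>z\<close>.\<close>
  have far: "\<exists>k\<ge>n. \<forall>j. L * fact k \<le> j \<longrightarrow> j + 2 * L < L * fact (Suc k) \<longrightarrow>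
      \<not> dist (nds_iter f 0 j (z x)) (nds_iter f 0 j (z y)) < \<delta> \<and> z x \<noteq> z y"
    if xy: "x \<noteq> y" for x y n
  proof -
    obtain i where i: "i \<in> x \<longleftrightarrow> i \<notin> y" using xy by blast
    \<comment> \<open>The stretch belonging to this \<open>q\<close> tests \<open>i\<close>, which
      tells \<open>x\<close> and \<open>y\<close> apart, and the second component makes it as late
      as required.\<close>
    define q where "q = prod_encode (i, n)"
    have q: "fst (prod_decode q) = i" "n \<le> q"
      by (simp_all add: q_def le_prod_encode_2)
    have "\<not> dist (nds_iter f 0 j (z x)) (nds_iter f 0 j (z y)) < \<delta> \<and> z x \<noteq> z y"
      if j: "L * fact (2 * q + 1) \<le> j" "j + 2 * L < L * fact (2 * q + 2)" for j
    proof -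
      \<comment> \<open>Position \<open>b\<close> of the block after the one containing
        \<open>j\<close>; the margin \<open>2 * L\<close> keeps it inside the stretch.\<close>
      define t where "t = b + Suc (j div L) * L"
      have "j = j div L * L + j mod L" "j mod L < L" using L by simp_all
      then have jt: "j \<le> t" "t \<le> j + 2 * L"
        using b(1) unfolding t_def mult_Suc by linarith+
      have "\<mu> t \<noteq> \<gamma> t" using b(2) unfolding t_def per .
      then have "\<alpha> x t \<noteq> \<alpha> y t"
        unfolding \<alpha>_def using j jt i q(1)
        by (intro coded_itinerary_differ[of L q]) (simp_all del: fact_Suc)
      then have "d \<le> dist (nds_iter f 0 t (z x)) (nds_iter f 0 t (z y))" by (rule sep)
      moreover from this have "z x \<noteq> z y" using d(1) by auto
      ultimately show ?thesis using \<delta>(2)[of j x y "t - j"] jt by fastforce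
    qed
    then show ?thesis
      using q(2) by (intro exI[of _ "2 * q + 1"]) (simp del: fact_Suc)
  qed

  \<comment> \<open>That \<open>M\<close> depends on \<epsilon> alone rests on the uniformity in
    \<open>n\<close> of the diameter hypothesis.\<close>
  have near: "\<exists>M. \<forall>x y q j. L * fact (2 * q) \<le> j \<longrightarrow> j + M < L * fact (Suc (2 * q)) \<longrightarrow>
      dist (nds_iter f 0 j (z x)) (nds_iter f 0 j (z y)) < \<epsilon>"
    if \<epsilon>: "\<epsilon> > 0" for \<epsilon>
  proof -
    obtain \<eta> where \<eta>: "\<eta> > 0"
      "\<And>x y n r. \<lbrakk>dist (nds_iter f 0 n (z x)) (nds_iter f 0 n (z y)) < \<eta>; r \<le> L\<rbrakk> \<Longrightarrow>
        dist (nds_iter f 0 (n + r) (z x)) (nds_iter f 0 (n + r) (z y)) < \<epsilon>"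
      using equi_continuous_in_orbit[OF assms(8) \<epsilon>, of L] zU unfolding U_def by metis
    obtain M where M: "\<And>n. \<bar>diameter (itinerary_set f W \<gamma> M n)\<bar> < \<eta>"
      using uniform_limitD[OF diam \<eta>(1)] unfolding eventually_sequentially
      by (auto simp: dist_real_def)
    have "dist (nds_iter f 0 j (z x)) (nds_iter f 0 j (z y)) < \<epsilon>"
      if j: "L * fact (2 * q) \<le> j" "j + M < L * fact (Suc (2 * q))" for x y q j
    proof -
      \<comment> \<open>The start of the block containing \<open>j\<close>. There \<gamma> is in
        phase 0, so all coded orbits follow \<gamma> from its beginning up to time
        \<open>n + M\<close>; equicontinuity covers the fewer than \<open>L\<close> steps from
        \<open>n\<close> to \<open>j\<close>.\<close>
      define n where "n = L * (j div L)"
      have n: "n \<le> j" "j - n \<le> L" "L * fact (2 * q) \<le> n"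
      proof -
        have "fact (2 * q) \<le> j div L"
          using j(1) L by (simp add: less_eq_div_iff_mult_less_eq mult.commute)
        then show "L * fact (2 * q) \<le> n" by (simp add: n_def)
      qed (use L in \<open>simp_all add: n_def minus_mult_div_eq_mod less_imp_le\<close>)
      have mem: "nds_iter f 0 n (z w) \<in> itinerary_set f W \<gamma> M n" for w
        unfolding itinerary_set_def
      proof (intro INT_I vimageI2)
        fix k assume "k \<in> {..M}"
        then have "\<alpha> w (n + k) = \<gamma> (n + k)"
          unfolding \<alpha>_def using n j by (intro coded_itinerary_eq_base[of L q]) (simp_all del: fact_Suc)
        also have "\<dots> = \<gamma> k" using per(2)[of k "j div L"] by (simp add: n_def ac_simps)
        finally show "nds_iter f n k (nds_iter f 0 n (z w)) \<in> W (\<gamma> k) (n + k)"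
          using z[of "n + k" w] nds_iter_nds_iter[of f 0 n k "z w"] by simp
      qed
      \<comment> \<open>A \<open>diameter\<close> bounds distances only in a bounded set;
        boundedness comes from the compact set \<open>V (\<gamma> 0)\<close>.\<close>
      have "\<gamma> 0 < N" using \<gamma>(1) by (simp add: subshift_def)
      moreover have "itinerary_set f W \<gamma> M n \<subseteq> W (\<gamma> 0) n"
        using INT_lower[of 0 "{..M}" "\<lambda>k. nds_iter f n k -` W (\<gamma> k) (n + k)"]
        by (simp add: itinerary_set_def)
      ultimately have "itinerary_set f W \<gamma> M n \<subseteq> V (\<gamma> 0)"
        using assms(11) by blast
      then have "bounded (itinerary_set f W \<gamma> M n)"
        using assms(7) \<open>\<gamma> 0 < N\<close> compact_imp_bounded bounded_subset by blast
      then have "dist (nds_iter f 0 n (z x)) (nds_iter f 0 n (z y)) < \<eta>"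
        using diameter_bounded_bound[OF _ mem mem, of x y] M[of n] by linarith
      then show ?thesis using \<eta>(2)[of n x y "j - n"] n by simp
    qed
    then show ?thesis by blast
  qed

  have far_inj: "z x \<noteq> z y" if xy: "x \<noteq> y" for x y
  proof -
    \<comment> \<open>From \<open>k = 3\<close> on the range of \<open>j\<close> is nonempty:
      \<open>k * fact k > 2\<close>, so \<open>j = L * fact k\<close> satisfies both bounds.\<close>
    obtain k where k: "k \<ge> 3" "\<And>j. L * fact k \<le> j \<Longrightarrow> j + 2 * L < L * fact (Suc k) \<Longrightarrow> z x \<noteq> z y"
      using far[OF xy, of 3] by blast
    have "fact k \<ge> (1::nat)" by (rule fact_ge_1)
    then have "fact k + 2 < (fact (Suc k) :: nat)"
      using mult_le_mono[of 3 k 1 "fact k :: nat"] k(1) by (simp add: algebra_simps)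
    then have "L * (fact k + 2) < L * fact (Suc k)" using L by (rule mult_strict_left_mono)
    then have "L * fact k + 2 * L < L * fact (Suc k)"
      by (simp add: distrib_left mult.commute del: fact_Suc)
    then show ?thesis by (rule k(2)[OF order_refl])
  qed
  have "uncountable (range z)"
    using uncountable_UNIV_nat_set far_inj countable_image_inj_on[of z UNIV]
    by (metis injI)
  moreover have "limsup (\<lambda>n. ereal (proximity_frequency f \<epsilon> (z x) (z y) n)) = 1"
    if \<epsilon>: "\<epsilon> > 0" for \<epsilon> x y
  proof -
    obtain M where M: "\<And>q j. L * fact (2 * q) \<le> j \<Longrightarrow> j + M < L * fact (Suc (2 * q)) \<Longrightarrow>
        dist (nds_iter f 0 j (z x)) (nds_iter f 0 j (z y)) < \<epsilon>"
      using near[OF \<epsilon>] by blast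
    show ?thesis
    proof (rule limsup_proximity_frequency_eq_1, rule thin_along_factorial[OF L, of M])
      \<comment> \<open>Even indices give the stretches in which all itineraries agree with
        \<gamma>.\<close>
      show "\<exists>k\<ge>n. \<forall>j. L * fact k \<le> j \<longrightarrow> j + M < L * fact (Suc k) \<longrightarrow>
          \<not> \<not> dist (nds_iter f 0 j (z x)) (nds_iter f 0 j (z y)) < \<epsilon>" for n
        by (rule exI[of _ "2 * n"]) (use M[of n] in \<open>simp del: fact_Suc\<close>)
    qed
  qed
  moreover have "liminf (\<lambda>n. ereal (proximity_frequency f \<delta> (z x) (z y) n)) = 0" if "x \<noteq> y" for x y
    by (rule liminf_proximity_frequency_eq_0, rule thin_along_factorial[OF L, of "2 * L"])
      (use far[OF that] in blast)
  ultimately have "distributionally_chaotic \<delta> f"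
    unfolding distributionally_chaotic_def by (intro exI[of _ "range z"]) (auto, metis)
  then show ?thesis using \<delta>(1) by blast
qed

end
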